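(* Let $q=\overrightarrow{\varepsilon}=(u_1,u_2,u_3)=u_1i+u_2j+u_3k$ be a spacelike unit pure split quaternion. Then for every $\theta\in\mathbb{R}$, $$e^{\theta\mathbf{L}_q}=\cosh\theta\,\mathbf{I}_4+\sinh\theta\,\mathbf{L}_q\quad\text{and}\quad e^{\theta\mathbf{R}_q}=\cosh\theta\,\mathbf{I}_4+\sinh\theta\,\mathbf{R}_q.$$
   Context: The split quaternions $\widehat{\mathbb{H}}$ form the real associative algebra with basis $\{1,i,j,k\}$ and products $i^2=-1$, $j^2=k^2=1$, $ij=k=-ji$, $jk=-i=-kj$, $ki=j=-ik$. For $q=q_0+q_1i+q_2j+q_3k$, put $I_q=q_0^2+q_1^2-q_2^2-q_3^2$ and $N_q=\sqrt{|I_q|}$. The split quaternion $q$ is timelike if $I_q>0$, spacelike if $I_q<0$, lightlike if $I_q=0$; it is pure if $q_0=0$ and unit if $N_q=1$. Pure split quaternions $u_1i+u_2j+u_3k$ are identified with vectors $(u_1,u_2,u_3)\in\mathbb{R}^3$. Thus a spacelike unit pure split quaternion is one with $-u_1^2+u_2^2+u_3^2=1$. The left and right matrix representations of $q$ (matrices of $p\mapsto qp$ and $p\mapsto pq$ in the basis $1,i,j,k$) are $$\mathbf{L}_q=\begin{bmatrix}q_0&-q_1&q_2&q_3\\ q_1&q_0&q_3&-q_2\\ q_2&q_3&q_0&-q_1\\ q_3&-q_2&q_1&q_0\end{bmatrix},\qquad \mathbf{R}_q=\begin{bmatrix}q_0&-q_1&q_2&q_3\\ q_1&q_0&-q_3&q_2\\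 q_2&-q_3&q_0&q_1\\ q_3&q_2&-q_1&q_0\end{bmatrix}.$$ $\mathbf{I}_4$ is the $4\times4$ identity matrix and $e^{A}$ denotes the matrix exponential. *)

theory Defs
  imports "HOL-Analysis.Analysis"
begin

section \<open>The algebra of split quaternions\<close>

datatype squat = SQuat (sq0: real) (sq1: real) (sq2: real) (sq3: real)

lemma squat_eq_iff: "p = q \<longleftrightarrow> sq0 p = sq0 q \<and> sq1 p = sq1 q \<and> sq2 p = sq2 q \<and> sq3 p = sq3 q"
  using squat.expand by blast

instantiation squat :: real_algebra_1
begin

definition zero_squat :: squat where
  "0 = SQuat 0 0 0 0"

definition one_squat :: squat where
  "1 = SQuat 1 0 0 0"

definition plus_squat :: "squat \<Rightarrow> squat \<Rightarrow> squat" where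
  "p + q = SQuat (sq0 p + sq0 q) (sq1 p + sq1 q) (sq2 p + sq2 q) (sq3 p + sq3 q)"

definition minus_squat :: "squat \<Rightarrow> squat \<Rightarrow> squat" where
  "p - q = SQuat (sq0 p - sq0 q) (sq1 p - sq1 q) (sq2 p - sq2 q) (sq3 p - sq3 q)"

definition uminus_squat :: "squat \<Rightarrow> squat" where
  "- q = SQuat (- sq0 q) (- sq1 q) (- sq2 q) (- sq3 q)"

definition scaleR_squat :: "real \<Rightarrow> squat \<Rightarrow> squat" where
  "c *\<^sub>R q = SQuat (c * sq0 q) (c * sq1 q) (c * sq2 q) (c * sq3 q)"

text \<open>Bilinear extension of the multiplication table of the basis, which is recovered
  in \<open>squat_basis_mult\<close>.\<close>

definition times_squat :: "squat \<Rightarrow> squat \<Rightarrow> squat" where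
  "p * q = SQuat
     (sq0 p * sq0 q - sq1 p * sq1 q + sq2 p * sq2 q + sq3 p * sq3 q)
     (sq0 p * sq1 q + sq1 p * sq0 q - sq2 p * sq3 q + sq3 p * sq2 q)
     (sq0 p * sq2 q + sq2 p * sq0 q + sq3 p * sq1 q - sq1 p * sq3 q)
     (sq0 p * sq3 q + sq3 p * sq0 q + sq1 p * sq2 q - sq2 p * sq1 q)"

instance
  by standard
    (simp_all add: squat_eq_iff zero_squat_def one_squat_def plus_squat_def minus_squat_def
      uminus_squat_def scaleR_squat_def times_squat_def algebra_simps)

end

definition squat_i :: squat where "squat_i = SQuat 0 1 0 0"
definition squat_j :: squat where "squat_j = SQuat 0 0 1 0"
definition squat_k :: squat where "squat_k = SQuat 0 0 0 1"

lemma squat_basis_mult: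
  "squat_i * squat_i = -1" "squat_j * squat_j = 1" "squat_k * squat_k = 1"
  "squat_i * squat_j = squat_k" "squat_j * squat_i = - squat_k"
  "squat_j * squat_k = - squat_i" "squat_k * squat_j = squat_i"
  "squat_k * squat_i = squat_j" "squat_i * squat_k = - squat_j"
  by (simp_all add: squat_i_def squat_j_def squat_k_def times_squat_def uminus_squat_def
      one_squat_def)

lemma squat_basis_expansion:
  "q = sq0 q *\<^sub>R 1 + sq1 q *\<^sub>R squat_i + sq2 q *\<^sub>R squat_j + sq3 q *\<^sub>R squat_k"
  by (simp add: squat_eq_iff squat_i_def squat_j_def squat_k_def one_squat_def
      plus_squat_def scaleR_squat_def)

definition squat_I :: "squat \<Rightarrow> real" where
  "squat_I q = (sq0 q)\<^sup>2 + (sq1 q)\<^sup>2 - (sq2 q)\<^sup>2 - (sq3 q)\<^sup>2"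

definition squat_N :: "squat \<Rightarrow> real" where
  "squat_N q = sqrt \<bar>squat_I q\<bar>"

definition spacelike :: "squat \<Rightarrow> bool" where
  "spacelike q \<longleftrightarrow> squat_I q < 0"

definition pure_squat :: "squat \<Rightarrow> bool" where
  "pure_squat q \<longleftrightarrow> sq0 q = 0"

definition unit_squat :: "squat \<Rightarrow> bool" where
  "unit_squat q \<longleftrightarrow> squat_N q = 1"


section \<open>Left and right matrix representations\<close>

definition L_mat :: "squat \<Rightarrow> real^4^4" where
  "L_mat q = vector
    [vector [sq0 q, - sq1 q,   sq2 q,   sq3 q],
     vector [sq1 q,   sq0 q,   sq3 q, - sq2 q],
     vector [sq2 q,   sq3 q,   sq0 q, - sq1 q],
     vector [sq3 q, - sq2 q,   sq1 q,   sq0 q]]"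

definition R_mat :: "squat \<Rightarrow> real^4^4" where
  "R_mat q = vector
    [vector [sq0 q, - sq1 q,   sq2 q,   sq3 q],
     vector [sq1 q,   sq0 q, - sq3 q,   sq2 q],
     vector [sq2 q, - sq3 q,   sq0 q,   sq1 q],
     vector [sq3 q,   sq2 q, - sq1 q,   sq0 q]]"

definition squat_coords :: "squat \<Rightarrow> real^4" where
  "squat_coords q = vector [sq0 q, sq1 q, sq2 q, sq3 q]"

lemma vector_4_nth:
  "(vector [a, b, c, d] :: ('a::zero)^4) $ 1 = a"
  "(vector [a, b, c, d] :: ('a::zero)^4) $ 2 = b"
  "(vector [a, b, c, d] :: ('a::zero)^4) $ 3 = c"
  "(vector [a, b, c, d] :: ('a::zero)^4) $ 4 = d"
  by (simp_all add: vector_def)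

lemma L_mat_mult: "L_mat q *v squat_coords p = squat_coords (q * p)"
  by (simp add: vec_eq_iff forall_4 matrix_vector_mult_def sum_4 L_mat_def squat_coords_def
      vector_4_nth times_squat_def algebra_simps)

lemma R_mat_mult: "R_mat q *v squat_coords p = squat_coords (p * q)"
  by (simp add: vec_eq_iff forall_4 matrix_vector_mult_def sum_4 R_mat_def squat_coords_def
      vector_4_nth times_squat_def algebra_simps)


section \<open>The matrix exponential\<close>

text \<open>On \<open>real^'n^'n\<close> the operations \<open>*\<close> and \<open>^\<close> act
  componentwise, so powers with respect to the matrix product \<open>**\<close> are
  defined separately.\<close>

primrec mat_pow :: "real^'n^'n \<Rightarrow> nat \<Rightarrow> real^'n^'n" where
  "mat_pow A 0 = mat 1"
| "mat_pow A (Suc m) = A ** mat_pow A m"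

definition mat_exp :: "real^'n^'n \<Rightarrow> real^'n^'n" where
  "mat_exp A = (\<Sum>m. (1 / fact m) *\<^sub>R mat_pow A m)"

lemma matrix_add_left: "(A + B) ** C = A ** C + B ** C" for A B C :: "real^'n^'n"
  by (simp add: matrix_matrix_mult_def vec_eq_iff sum.distrib distrib_right)

lemma matrix_scaleR_left: "(c *\<^sub>R A) ** B = c *\<^sub>R (A ** B)" for A B :: "real^'n^'n"
  by (simp add: matrix_matrix_mult_def vec_eq_iff sum_distrib_left mult.assoc)

lemma matrix_scaleR_right: "A ** (c *\<^sub>R B) = c *\<^sub>R (A ** B)" for A B :: "real^'n^'n"
  by (simp add: matrix_matrix_mult_def vec_eq_iff sum_distrib_left mult.left_commute)

lemma summable_mat_exp:
  fixes A :: "real^'n^'n"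
  shows "summable (\<lambda>m. (1 / fact m) *\<^sub>R mat_pow A m)"
proof -
  have "bilinear ((**) :: real^'n^'n \<Rightarrow> real^'n^'n \<Rightarrow> real^'n^'n)"
    unfolding bilinear_def
    by (intro conjI allI linearI)
      (simp_all add: matrix_add_ldistrib matrix_add_left matrix_scaleR_left matrix_scaleR_right)
  then have "bounded_bilinear ((**) :: real^'n^'n \<Rightarrow> real^'n^'n \<Rightarrow> real^'n^'n)"
    by (simp only: bilinear_conv_bounded_bilinear)
  from bounded_bilinear.nonneg_bounded[OF this]
  obtain K where K: "K \<ge> 0"
    "\<And>(B :: real^'n^'n) (C :: real^'n^'n). norm (B ** C) \<le> norm B * norm C * K"
    by auto
  let ?c = "norm (mat 1 :: real^'n^'n)" and ?r = "norm A * K"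
  have pow: "norm (mat_pow A m) \<le> ?c * ?r ^ m" for m
  proof (induction m)
    case (Suc m)
    have "norm (mat_pow A (Suc m)) \<le> ?r * norm (mat_pow A m)"
      using K(2)[of A "mat_pow A m"] by (simp add: mult_ac)
    also have "\<dots> \<le> ?r * (?c * ?r ^ m)"
      using Suc K(1) by (intro mult_left_mono) auto
    finally show ?case by (simp add: mult_ac)
  qed simp
  show ?thesis
  proof (rule summable_comparison_test')
    show "summable (\<lambda>m. ?c * (inverse (fact m) * ?r ^ m))"
      by (intro summable_mult summable_exp)
    show "norm ((1 / fact m) *\<^sub>R mat_pow A m) \<le> ?c * (inverse (fact m) * ?r ^ m)"
      if "m \<ge> 0" for m
      using mult_left_mono[OF pow[of m], of "inverse (fact m)"]
      by (simp add: divide_inverse mult_ac)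
  qed
qed

end

theory Submission
  imports Defs
begin

text \<open>A pure split quaternion satisfies \<open>q * q = - I\<^sub>q\<close>, so a spacelike unit one is a square
  root of \<open>1\<close>. Left multiplication is a homomorphism and right multiplication an antihomomorphism
  into the matrix algebra; both preserve squares and the unit, so both matrices of \<open>q\<close> are
  involutions (\<open>L_mat_involution\<close>, \<open>R_mat_involution\<close>). The powers of an involution \<open>A\<close> alternate
  between the identity and \<open>A\<close>, hence the exponential series of \<open>\<theta> A\<close> separates into its even
  part, the power series of \<open>cosh\<close> times the identity, and its odd part, the power series of
  \<open>sinh\<close> times \<open>A\<close> (\<open>mat_exp_involution\<close>). This is the hyperbolic counterpart of Euler's
  formula, with a square root of \<open>1\<close> in place of one of \<open>-1\<close>.\<close>

lemma mat_pow_involution: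
  fixes A :: "real^'n^'n"
  assumes "A ** A = mat 1"
  shows "mat_pow (t *\<^sub>R A) m = t ^ m *\<^sub>R (if even m then mat 1 else A)"
  by (induction m) (simp_all add: assms matrix_scaleR_left matrix_scaleR_right)

lemma mat_exp_involution:
  fixes A :: "real^'n^'n"
  assumes "A ** A = mat 1"
  shows "mat_exp (t *\<^sub>R A) = cosh t *\<^sub>R mat 1 + sinh t *\<^sub>R A"
proof -
  let ?c = "\<lambda>m. if even m then t ^ m /\<^sub>R fact m else 0"
  let ?s = "\<lambda>m. if even m then 0 else t ^ m /\<^sub>R fact m"
  have "(\<lambda>m. ?c m *\<^sub>R mat 1 + ?s m *\<^sub>R A) sums (cosh t *\<^sub>R mat 1 + sinh t *\<^sub>R A)"
    by (intro sums_add sums_scaleR_left cosh_converges sinh_converges)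
  moreover have "?c m *\<^sub>R mat 1 + ?s m *\<^sub>R A = (1 / fact m) *\<^sub>R mat_pow (t *\<^sub>R A) m" for m
    by (simp add: mat_pow_involution[OF assms] divide_inverse)
  ultimately show ?thesis
    by (simp add: mat_exp_def sums_iff)
qed

lemma L_mat_times: "L_mat (p * q) = L_mat p ** L_mat q"
  by (simp add: vec_eq_iff forall_4 matrix_matrix_mult_def sum_4 L_mat_def
      vector_4_nth times_squat_def algebra_simps)

lemma R_mat_times: "R_mat (p * q) = R_mat q ** R_mat p"
  by (simp add: vec_eq_iff forall_4 matrix_matrix_mult_def sum_4 R_mat_def
      vector_4_nth times_squat_def algebra_simps)

lemma L_mat_one: "L_mat 1 = mat 1"
  by (simp add: vec_eq_iff forall_4 mat_def L_mat_def vector_4_nth one_squat_def)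

lemma R_mat_one: "R_mat 1 = mat 1"
  by (simp add: vec_eq_iff forall_4 mat_def R_mat_def vector_4_nth one_squat_def)

lemma L_mat_involution: "q * q = 1 \<Longrightarrow> L_mat q ** L_mat q = mat 1"
  by (metis L_mat_times L_mat_one)

lemma R_mat_involution: "q * q = 1 \<Longrightarrow> R_mat q ** R_mat q = mat 1"
  by (metis R_mat_times R_mat_one)

text \<open>The basis vectors \<open>i\<close>, \<open>j\<close>, \<open>k\<close> anticommute, so the mixed terms of \<open>q * q\<close> cancel in
  pairs and only the squares of the coordinates survive.\<close>

lemma pure_squat_square:
  assumes "pure_squat q"
  shows "q * q = (- squat_I q) *\<^sub>R 1"
  using assms
  by (simp add: pure_squat_def squat_I_def squat_eq_iff times_squat_def scaleR_squat_def
      one_squat_def power2_eq_square)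

lemma spacelike_unit_squat_I:
  assumes "unit_squat q" "spacelike q"
  shows "squat_I q = -1"
  using assms by (simp add: unit_squat_def squat_N_def spacelike_def)

theorem theorem7:
  fixes q :: squat and u1 u2 u3 \<theta> :: real
  assumes "q = u1 *\<^sub>R squat_i + u2 *\<^sub>R squat_j + u3 *\<^sub>R squat_k"
    and "pure_squat q" and "unit_squat q" and "spacelike q"
  shows "mat_exp (\<theta> *\<^sub>R L_mat q) = cosh \<theta> *\<^sub>R mat 1 + sinh \<theta> *\<^sub>R L_mat q
       \<and> mat_exp (\<theta> *\<^sub>R R_mat q) = cosh \<theta> *\<^sub>R mat 1 + sinh \<theta> *\<^sub>R R_mat q"
proof -
  have "q * q = 1"
    using assms by (simp add: pure_squat_square spacelike_unit_squat_I)
  then show ?thesis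
    by (simp add: mat_exp_involution L_mat_involution R_mat_involution)
qed

end
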